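(* Let $b\ge 1$ be an integer. A probability measure on $\{0,1,\dots,b-1\}^{\mathbb N}$ is sofic if and only if it is linearly representable.
   Context: Here $\mathbb N=\{1,2,\dots\}$, and $\{0,\dots,b-1\}^{\mathbb N}$ carries the product topology and its Borel $\sigma$-algebra. The cylinder sets are $[\omega_1\dots\omega_n]=\{(\xi_i)_{i\in\mathbb N}: \xi_1\dots\xi_n=\omega_1\dots\omega_n\}$ and the shift is $\sigma((\omega_n)_n)=(\omega_{n+1})_n$. (Markov measure.) A (homogeneous, not necessarily shift-invariant) Markov probability measure on $\{0,\dots,m-1\}^{\mathbb N}$ is a measure $\mu$ such that $\mu[\omega_1\dots\omega_n]=p_{\omega_1}p_{\omega_1\omega_2}\cdots p_{\omega_{n-1}\omega_n}$ for all cylinder sets, where $(p_0,\dots,p_{m-1})$ is a positive probability vector and $(p_{ij})_{0\le i,j\le m-1}$ is a nonnegative stochastic matrix (each row sums to $1$). (Sofic measure.) A probability measure on $\{0,\dots,b-1\}^{\mathbb N}$ is called sofic if, for some $m\ge1$, it is the image of a Markov probability measure on $\{0,\dots,m-1\}^{\mathbb N}$ by a continuous morphism $\varphi:\{0,\dots,m-1\}^{\mathbb N}\to\{0,\dots,b-1\}^{\mathbb N}$, i.e. a continuous map commuting with the shift. This morphism can be chosen letter-to-letter, i.e. $\varphi((\omega_n)_n)=(\psi(\omega_n))_n$ for a map $\psi:\{0,\dots,m-1\}\to\{0,\dots,b-1\}$. (Linearly representable measure.) A probability measure $\eta$ on $\{0,\dots,b-1\}^{\mathbb N}$ is called linearly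 representable if there exist $r\ge 1$, nonnegative $r$-dimensional row vectors $R_0,\dots,R_{b-1}$, nonnegative $r\times r$ matrices $M_0,\dots,M_{b-1}$, and a positive $r$-dimensional column vector $C$ such that $\big(\sum_i R_i\big)C=1$, $\big(\sum_i M_i\big)C=C$, and $\eta[\omega_1\dots\omega_n]=R_{\omega_1}M_{\omega_2}\cdots M_{\omega_n}C$ for all $n\ge1$ and all $\omega_1,\dots,\omega_n\in\{0,\dots,b-1\}$.
   Formalization: The initial probability vector of a Markov measure is only required to be nonnegative, not strictly positive; with strict positivity the claim fails for b ≥ 2, e.g. for the point mass at 0111…, which is linearly representable but would not be sofic. *)

theory Defs
  imports "HOL-Probability.Probability" "Jordan_Normal_Form.Matrix"
begin

no_notation inner (infix "\<bullet>" 70)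
no_notation vec_nth (infixl "$" 90)

subsection \<open>The sequence space\<close>

text \<open>Sequences are indexed from 0, so the letter \<open>\<omega>\<^sub>1\<close> of the usual notation is \<open>x 0\<close>.\<close>

definition seq_space :: "nat \<Rightarrow> (nat \<Rightarrow> nat) topology" where
  "seq_space b = product_topology (\<lambda>_. discrete_topology {..<b}) UNIV"

definition seq_borel :: "nat \<Rightarrow> (nat \<Rightarrow> nat) measure" where
  "seq_borel b = sigma (topspace (seq_space b)) {U. openin (seq_space b) U}"

definition shift :: "(nat \<Rightarrow> nat) \<Rightarrow> (nat \<Rightarrow> nat)" where
  "shift x = (\<lambda>n. x (Suc n))"

definition cylinder :: "nat \<Rightarrow> nat list \<Rightarrow> (nat \<Rightarrow> nat) set" where
  "cylinder b w = {x \<in> topspace (seq_space b). \<forall>i<length w. x i = w ! i}"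

definition words :: "nat \<Rightarrow> nat list set" where
  "words b = {w. w \<noteq> [] \<and> set w \<subseteq> {..<b}}"

definition prob_measure_on_seq :: "nat \<Rightarrow> (nat \<Rightarrow> nat) measure \<Rightarrow> bool" where
  "prob_measure_on_seq b \<eta> \<longleftrightarrow> prob_space \<eta> \<and> sets \<eta> = sets (seq_borel b)"

subsection \<open>Markov and sofic measures\<close>

text \<open>The initial vector \<open>p\<close> is only required to be entrywise nonnegative. With a strictly positive
  \<open>p\<close>, a Markov measure \<open>\<mu>\<close>, and hence each of its images under a continuous morphism, would dominate
  its own image under the shift up to a constant factor. The point mass at \<open>0111\<dots>\<close> would then
  fail to be sofic, although it is linearly representable
  (\<open>r = 1\<close>, \<open>R\<^sub>0 = M\<^sub>1 = C = 1\<close>, \<open>R\<^sub>1 = M\<^sub>0 = 0\<close>).\<close>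

definition markov_measure :: "nat \<Rightarrow> (nat \<Rightarrow> nat) measure \<Rightarrow> bool" where
  "markov_measure m \<mu> \<longleftrightarrow> prob_measure_on_seq m \<mu> \<and>
     (\<exists>(p :: nat \<Rightarrow> real) (P :: nat \<Rightarrow> nat \<Rightarrow> real).
        (\<forall>i<m. 0 \<le> p i) \<and> (\<Sum>i<m. p i) = 1 \<and>
        (\<forall>i<m. \<forall>j<m. 0 \<le> P i j) \<and> (\<forall>i<m. (\<Sum>j<m. P i j) = 1) \<and>
        (\<forall>w\<in>words m. measure \<mu> (cylinder m w) =
           p (w ! 0) * (\<Prod>k<length w - 1. P (w ! k) (w ! Suc k))))"

definition continuous_morphism :: "nat \<Rightarrow> nat \<Rightarrow> ((nat \<Rightarrow> nat) \<Rightarrow> (nat \<Rightarrow> nat)) \<Rightarrow> bool" where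
  "continuous_morphism m b \<phi> \<longleftrightarrow> continuous_map (seq_space m) (seq_space b) \<phi> \<and>
     (\<forall>x\<in>topspace (seq_space m). \<phi> (shift x) = shift (\<phi> x))"

definition sofic :: "nat \<Rightarrow> (nat \<Rightarrow> nat) measure \<Rightarrow> bool" where
  "sofic b \<eta> \<longleftrightarrow> (\<exists>m\<ge>1. \<exists>\<mu> \<phi>. markov_measure m \<mu> \<and> continuous_morphism m b \<phi> \<and>
     \<eta> = distr \<mu> (seq_borel b) \<phi>)"

subsection \<open>Linearly representable measures\<close>

text \<open>Row and column vectors are both of type \<open>real vec\<close>; the product of a row with a column is
  the scalar product.\<close>

definition linearly_representable :: "nat \<Rightarrow> (nat \<Rightarrow> nat) measure \<Rightarrow> bool" where
  "linearly_representable b \<eta> \<longleftrightarrow>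
     (\<exists>r\<ge>1. \<exists>(R :: nat \<Rightarrow> real Matrix.vec) (M :: nat \<Rightarrow> real Matrix.mat) (C :: real Matrix.vec).
        (\<forall>i<b. R i \<in> carrier_vec r \<and> (\<forall>j<r. 0 \<le> R i $ j)) \<and>
        (\<forall>i<b. M i \<in> carrier_mat r r \<and> (\<forall>j<r. \<forall>k<r. 0 \<le> M i $$ (j, k))) \<and>
        C \<in> carrier_vec r \<and> (\<forall>j<r. 0 < C $ j) \<and>
        Matrix.vec r (\<lambda>j. \<Sum>i<b. R i $ j) \<bullet> C = 1 \<and>
        Matrix.mat r r (\<lambda>(j, k). \<Sum>i<b. M i $$ (j, k)) *\<^sub>v C = C \<and>
        (\<forall>w\<in>words b. measure \<eta> (cylinder b w) =
           R (hd w) \<bullet> (foldr (\<lambda>a A. M a * A) (tl w) (1\<^sub>m r) *\<^sub>v C)))"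

end

theory Submission
  imports Defs
begin

text \<open>
  A linear representation is a Markov chain in disguise: its index set plays the role of the set of
  hidden states, the matrices \<open>M\<^sub>a\<close> record the transitions during which the letter \<open>a\<close> is
  emitted, and the positive vector \<open>C\<close>, an eigenvector for the eigenvalue 1 of \<open>\<Sum>\<^sub>a M\<^sub>a\<close>, is the
  change of scale which turns \<open>\<Sum>\<^sub>a M\<^sub>a\<close> into a stochastic matrix.

  \<^emph>\<open>From sofic to linear.\<close> Since the sequence space is compact, the first letter of \<open>\<phi> x\<close> depends
  only on the first \<open>k\<close> letters of \<open>x\<close> for some fixed \<open>k\<close>, and commutation with the shift makes
  \<open>\<phi>\<close> a sliding block map (\<open>morphism_imp_block_map\<close>). Take the words of length \<open>k\<close> as states. A state
  moves by dropping its first letter and appending a letter \<open>c\<close>, with the Markov probability of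
  passing from its last letter to \<open>c\<close>, and emits the letter that the block map assigns to the new
  block. By the Markov property the probability that the image sequence starts with
  \<open>w\<close> is a sum over paths of states (\<open>measure_block_event\<close>), which is a product of matrices applied to
  \<open>C = (1,\<dots>,1)\<close>.

  \<^emph>\<open>From linear to sofic.\<close> Take as states the pairs \<open>(a, j)\<close> of a letter and an index, and let the
  chain start in \<open>(a, j)\<close> with probability \<open>R\<^sub>a(j) C(j)\<close> and move from \<open>(a, i)\<close> to \<open>(a', j)\<close> with
  probability \<open>M\<^sub>a\<^sub>'(i, j) C(j) / C(i)\<close>. The two normalisation conditions on \<open>R\<close>, \<open>M\<close>, \<open>C\<close> say
  exactly that these are probabilities. The letter-to-letter map \<open>(a, j) \<mapsto> a\<close>
  sends the chain to a measure with the given values on cylinders, since the factors \<open>C\<close>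
  telescope; and cylinders determine a measure (\<open>prob_measure_on_seq_eqI\<close>). The existence of the
  Markov measure is \<open>markov_measure_exists\<close>.

  Both directions use the same formula for block images of Markov measures, with blocks of length
  1 in the second one.
\<close>

section \<open>Cylinders generate the Borel sets\<close>

lemma mem_seq_space: "x \<in> topspace (seq_space b) \<longleftrightarrow> (\<forall>i. x i < b)"
  by (auto simp: seq_space_def PiE_iff)

lemma mem_cylinder: "x \<in> cylinder b w \<longleftrightarrow> (\<forall>i. x i < b) \<and> (\<forall>i<length w. x i = w ! i)"
  by (simp add: cylinder_def mem_seq_space)

lemma cylinder_subset: "cylinder b w \<subseteq> topspace (seq_space b)"
  by (auto simp: cylinder_def)

lemma cylinder_Nil: "cylinder b [] = topspace (seq_space b)"
  by (auto simp: cylinder_def)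

lemma cylinder_eq_empty:
  assumes "\<not> set w \<subseteq> {..<b}"
  shows "cylinder b w = {}"
proof -
  obtain i where i: "i < length w" "\<not> w ! i < b"
    using assms by (auto simp: subset_eq in_set_conv_nth)
  then have "x \<notin> cylinder b w" for x
    unfolding mem_cylinder by metis
  then show ?thesis by blast
qed

lemma openin_cylinder: "openin (seq_space b) (cylinder b w)"
proof -
  let ?S = "\<lambda>i. if i < length w then {..<b} \<inter> {w ! i} else {..<b}"
  have "x \<in> cylinder b w \<longleftrightarrow> (\<forall>i. x i \<in> ?S i)" for x
    unfolding mem_cylinder by (auto split: if_splits)
  then have "cylinder b w = PiE UNIV ?S"
    by (auto simp: PiE_iff)
  moreover have "finite {i. ?S i \<noteq> {..<b}}"
    by (rule finite_subset[of _ "{..<length w}"]) auto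
  ultimately show ?thesis
    unfolding seq_space_def by (auto simp: openin_PiE_gen)
qed

text \<open>A basic open set of the product constrains finitely many coordinates, and fixing all letters
  before some time \<open>n\<close> controls all of them. Hence the
  cylinders, of which there are only countably many, generate the Borel sets, and a continuous map
  into a discrete space is locally determined by a prefix.\<close>

lemma openin_contains_cylinder:
  assumes "openin (seq_space b) U" "x \<in> U"
  shows "\<exists>n. cylinder b (map x [0..<n]) \<subseteq> U"
proof -
  obtain V where V: "finite {i. V i \<noteq> {..<b}}" "x \<in> PiE UNIV V" "PiE UNIV V \<subseteq> U"
    using assms unfolding seq_space_def openin_product_topology_alt by auto
  obtain n where n: "\<forall>i\<in>{i. V i \<noteq> {..<b}}. i < n"
    using finite_nat_set_iff_bounded V(1) by blast
  have "cylinder b (map x [0..<n]) \<subseteq> PiE UNIV V"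
  proof
    fix y assume y: "y \<in> cylinder b (map x [0..<n])"
    have "y i \<in> V i" for i
      using y n V(2) by (cases "i < n") (auto simp: mem_cylinder PiE_iff)
    then show "y \<in> PiE UNIV V" by (simp add: PiE_iff)
  qed
  with V(3) show ?thesis by blast
qed

lemma space_seq_borel: "space (seq_borel b) = topspace (seq_space b)"
  unfolding seq_borel_def by (intro space_measure_of) (auto dest: openin_subset)

lemma openin_in_sets_seq_borel: "openin (seq_space b) U \<Longrightarrow> U \<in> sets (seq_borel b)"
  unfolding seq_borel_def by (subst sets_measure_of) (auto dest: openin_subset)

lemma sets_seq_borel:
  "sets (seq_borel b) = sigma_sets (topspace (seq_space b)) (range (cylinder b))"
proof -
  let ?X = "topspace (seq_space b)"
  have "sets (seq_borel b) = sigma_sets ?X {U. openin (seq_space b) U}"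
    unfolding seq_borel_def by (intro sets_measure_of) (auto dest: openin_subset)
  also have "\<dots> = sigma_sets ?X (range (cylinder b))"
  proof (rule sigma_sets_eqI)
    fix U assume "U \<in> {U. openin (seq_space b) U}"
    then have U: "openin (seq_space b) U" by simp
    have "U = (\<Union>w\<in>{w. cylinder b w \<subseteq> U}. cylinder b w)"
    proof (intro equalityI subsetI)
      fix x assume x: "x \<in> U"
      obtain n where "cylinder b (map x [0..<n]) \<subseteq> U"
        using openin_contains_cylinder[OF U x] by blast
      moreover have "x \<in> cylinder b (map x [0..<n])"
        using x openin_subset[OF U] by (auto simp: cylinder_def)
      ultimately show "x \<in> (\<Union>w\<in>{w. cylinder b w \<subseteq> U}. cylinder b w)" by blast
    qed auto
    moreover have "(\<Union>w\<in>{w. cylinder b w \<subseteq> U}. cylinder b w) \<in> sigma_sets ?X (range (cylinder b))"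
      by (rule sigma_sets_UNION) auto
    ultimately show "U \<in> sigma_sets ?X (range (cylinder b))" by simp
  qed (auto intro: openin_cylinder)
  finally show ?thesis .
qed

lemma Int_stable_cylinders: "Int_stable (range (cylinder b))"
proof -
  have "cylinder b v \<inter> cylinder b w \<in> range (cylinder b)" if "length v \<le> length w" for v w
  proof (cases "\<forall>i<length v. v ! i = w ! i")
    case True
    with that have "cylinder b v \<inter> cylinder b w = cylinder b w"
      by (auto simp: mem_cylinder)
    then show ?thesis by auto
  next
    case False
    then obtain i where "i < length v" "v ! i \<noteq> w ! i" by blast
    \<comment> \<open>the letter \<open>b\<close> is not in the alphabet, so this cylinder is empty\<close>
    with that have "cylinder b v \<inter> cylinder b w = cylinder b [b]"
      by (fastforce simp: mem_cylinder)
    then show ?thesis by auto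
  qed
  then show ?thesis
    unfolding Int_stable_def by (metis (no_types, lifting) Int_commute imageE nle_le)
qed

lemma prob_measure_on_seqD:
  assumes "prob_measure_on_seq b \<mu>"
  shows "prob_space \<mu>" and "sets \<mu> = sets (seq_borel b)" and "space \<mu> = topspace (seq_space b)"
  using assms sets_eq_imp_space_eq[of \<mu> "seq_borel b"]
  by (auto simp: prob_measure_on_seq_def space_seq_borel)

lemma cylinder_in_sets: "prob_measure_on_seq b \<mu> \<Longrightarrow> cylinder b w \<in> sets \<mu>"
  by (auto simp: prob_measure_on_seqD sets_seq_borel)

lemma prob_measure_on_seq_eqI:
  assumes \<mu>: "prob_measure_on_seq b \<mu>" and \<nu>: "prob_measure_on_seq b \<nu>"
    and eq: "\<And>w. w \<in> words b \<Longrightarrow> measure \<mu> (cylinder b w) = measure \<nu> (cylinder b w)"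
  shows "\<mu> = \<nu>"
proof -
  interpret M: prob_space \<mu> by (rule prob_measure_on_seqD[OF \<mu>])
  interpret N: prob_space \<nu> by (rule prob_measure_on_seqD[OF \<nu>])
  show ?thesis
  proof (rule measure_eqI_generator_eq[where E = "range (cylinder b)"
        and \<Omega> = "topspace (seq_space b)" and A = "\<lambda>_. cylinder b []"])
    fix X assume "X \<in> range (cylinder b)"
    then obtain w where w: "X = cylinder b w" by auto
    have "measure \<mu> (cylinder b w) = measure \<nu> (cylinder b w)"
    proof (cases "w = []")
      case True
      then show ?thesis
        using M.prob_space N.prob_space
        by (simp add: cylinder_Nil prob_measure_on_seqD[OF \<mu>] prob_measure_on_seqD[OF \<nu>])
    next
      case False
      then show ?thesis
        using eq[of w] cylinder_eq_empty[of w b] by (cases "set w \<subseteq> {..<b}") (auto simp: words_def)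
    qed
    then show "emeasure \<mu> X = emeasure \<nu> X"
      by (simp add: w M.emeasure_eq_measure N.emeasure_eq_measure)
  next
    show "sets \<mu> = sigma_sets (topspace (seq_space b)) (range (cylinder b))"
      "sets \<nu> = sigma_sets (topspace (seq_space b)) (range (cylinder b))"
      by (simp_all add: prob_measure_on_seqD[OF \<mu>] prob_measure_on_seqD[OF \<nu>] sets_seq_borel)
    show "range (cylinder b) \<subseteq> Pow (topspace (seq_space b))"
      using cylinder_subset by blast
    show "range (\<lambda>_::nat. cylinder b []) \<subseteq> range (cylinder b)" by blast
    show "(\<Union>i::nat. cylinder b []) = topspace (seq_space b)"
      by (simp add: cylinder_Nil)
    show "emeasure \<mu> (cylinder b []) \<noteq> \<infinity>"
      by (simp add: M.emeasure_eq_measure)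
  qed (rule Int_stable_cylinders)
qed

lemma measurable_seq_borelI:
  assumes "\<And>x. x \<in> space M \<Longrightarrow> \<phi> x \<in> topspace (seq_space b)"
    and "\<And>w. \<phi> -` cylinder b w \<inter> space M \<in> sets M"
  shows "\<phi> \<in> measurable M (seq_borel b)"
proof (rule measurable_sigma_sets[OF sets_seq_borel])
  show "range (cylinder b) \<subseteq> Pow (topspace (seq_space b))"
    using cylinder_subset by blast
  show "\<phi> \<in> space M \<rightarrow> topspace (seq_space b)"
    using assms(1) by (rule Pi_I)
  show "\<phi> -` A \<inter> space M \<in> sets M" if "A \<in> range (cylinder b)" for A
    using that assms(2) by blast
qed

lemma prob_measure_on_seq_distr:
  assumes "prob_space M" "\<phi> \<in> measurable M (seq_borel b)"
  shows "prob_measure_on_seq b (distr M (seq_borel b) \<phi>)"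
  using assms by (auto simp: prob_measure_on_seq_def intro: prob_space.prob_space_distr)

section \<open>Continuous morphisms are block maps\<close>

lemma morphism_measurable:
  assumes "continuous_map (seq_space m) (seq_space b) \<phi>" "prob_measure_on_seq m \<mu>"
  shows "\<phi> \<in> measurable \<mu> (seq_borel b)"
proof (rule measurable_seq_borelI)
  fix w
  have "openin (seq_space m) {x \<in> topspace (seq_space m). \<phi> x \<in> cylinder b w}"
    by (rule openin_continuous_map_preimage[OF assms(1) openin_cylinder])
  moreover have "{x \<in> topspace (seq_space m). \<phi> x \<in> cylinder b w} = \<phi> -` cylinder b w \<inter> space \<mu>"
    using assms(2) by (auto simp: prob_measure_on_seqD)
  ultimately show "\<phi> -` cylinder b w \<inter> space \<mu> \<in> sets \<mu>"
    using prob_measure_on_seqD(2)[OF assms(2)] openin_in_sets_seq_borel by metis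
next
  fix x assume "x \<in> space \<mu>"
  then show "\<phi> x \<in> topspace (seq_space b)"
    using assms continuous_map_image_subset_topspace[OF assms(1)]
    by (auto simp: prob_measure_on_seqD)
qed

lemma compact_seq_space: "compact_space (seq_space m)"
  unfolding seq_space_def compact_space_product_topology
  by (intro disjI2 ballI) (simp add: compact_space_discrete_topology)

lemma funpow_shift: "(shift ^^ i) x = (\<lambda>n. x (i + n))"
  by (induction i) (auto simp: shift_def)

text \<open>This is the theorem of Curtis, Hedlund and Lyndon. Every point has a cylinder neighbourhood on
  which the first letter of \<open>\<phi> x\<close> is constant; by compactness finitely many of these
  cylinders suffice, and \<open>k\<close> is any bound for the lengths of their defining words. The shift carries
  the rule from coordinate 0 to all others.\<close>

lemma morphism_imp_block_map:
  assumes \<phi>: "continuous_morphism m b \<phi>" and m: "m \<ge> 1"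
  obtains k \<psi> where "k \<ge> 1"
    and "\<And>x i. x \<in> topspace (seq_space m) \<Longrightarrow> \<phi> x i = \<psi> (map x [i..<i + k])"
proof -
  let ?X = "topspace (seq_space m)"
  have cont: "continuous_map (seq_space m) (seq_space b) \<phi>"
    and comm: "\<And>x. x \<in> ?X \<Longrightarrow> \<phi> (shift x) = shift (\<phi> x)"
    using \<phi> by (auto simp: continuous_morphism_def)
  define \<U> where "\<U> = {cylinder m u | u. \<forall>x\<in>cylinder m u. \<forall>y\<in>cylinder m u. \<phi> x 0 = \<phi> y 0}"
  have "\<exists>\<F>. finite \<F> \<and> \<F> \<subseteq> \<U> \<and> ?X \<subseteq> \<Union>\<F>"
  proof (rule compactinD)
    show "compactin (seq_space m) ?X"
      using compact_seq_space by (simp add: compact_space_def)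
    show "openin (seq_space m) U" if "U \<in> \<U>" for U
      using that by (auto simp: \<U>_def openin_cylinder)
    show "?X \<subseteq> \<Union>\<U>"
    proof
      fix x assume x: "x \<in> ?X"
      have "openin (seq_space m) {y \<in> ?X. \<phi> y \<in> cylinder b [\<phi> x 0]}"
        by (rule openin_continuous_map_preimage[OF cont openin_cylinder])
      moreover have "\<phi> x \<in> topspace (seq_space b)"
        using x continuous_map_image_subset_topspace[OF cont] by auto
      then have "x \<in> {y \<in> ?X. \<phi> y \<in> cylinder b [\<phi> x 0]}"
        using x by (simp add: mem_cylinder mem_seq_space)
      ultimately obtain n where n: "cylinder m (map x [0..<n]) \<subseteq> {y \<in> ?X. \<phi> y \<in> cylinder b [\<phi> x 0]}"
        using openin_contains_cylinder by blast
      then have "cylinder m (map x [0..<n]) \<in> \<U>"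
        by (auto simp: \<U>_def mem_cylinder subset_iff intro!: exI[of _ "map x [0..<n]"])
      moreover have "x \<in> cylinder m (map x [0..<n])"
        using x by (auto simp: cylinder_def)
      ultimately show "x \<in> \<Union>\<U>" by blast
    qed
  qed
  then obtain \<F> where \<F>: "finite \<F>" "\<F> \<subseteq> \<U>" "?X \<subseteq> \<Union>\<F>" by blast
  have "\<exists>u. U = cylinder m u \<and> (\<forall>x\<in>U. \<forall>y\<in>U. \<phi> x 0 = \<phi> y 0)" if "U \<in> \<F>" for U
    using that \<F>(2) by (auto simp: \<U>_def)
  then obtain c where c: "\<And>U. U \<in> \<F> \<Longrightarrow> U = cylinder m (c U)"
      "\<And>U x y. U \<in> \<F> \<Longrightarrow> x \<in> U \<Longrightarrow> y \<in> U \<Longrightarrow> \<phi> x 0 = \<phi> y 0" by metis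
  \<comment> \<open>the successor makes \<open>k\<close> positive, so that blocks have a last letter\<close>
  define k where "k = Suc (Max (insert 0 ((length \<circ> c) ` \<F>)))"
  have k: "length (c U) \<le> k" if "U \<in> \<F>" for U
    using that \<F>(1) unfolding k_def by (intro le_SucI Max_ge) auto
  have local_rule: "\<phi> x 0 = \<phi> y 0" if x: "x \<in> ?X" and y: "y \<in> ?X" "\<And>i. i < k \<Longrightarrow> x i = y i" for x y
  proof -
    obtain U where U: "U \<in> \<F>" "x \<in> U" using \<F>(3) x by blast
    have "x \<in> cylinder m (c U)" using U c(1) by blast
    then have "y \<in> cylinder m (c U)"
      using y k[OF U(1)] by (auto simp: mem_cylinder mem_seq_space)
    then show ?thesis using c U by blast
  qed
  define \<psi> where "\<psi> u = \<phi> (\<lambda>i. if i < length u then u ! i else 0) 0" for u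
  have "\<phi> x i = \<psi> (map x [i..<i + k])" if x: "x \<in> ?X" for x i
  proof -
    have "(shift ^^ j) x \<in> ?X \<and> \<phi> ((shift ^^ j) x) = (shift ^^ j) (\<phi> x)" for j
      by (induction j) (use x comm in \<open>auto simp: mem_seq_space shift_def funpow_shift\<close>)
    then have "\<phi> x i = \<phi> ((shift ^^ i) x) 0" by (simp add: funpow_shift)
    also have "\<dots> = \<psi> (map x [i..<i + k])"
      unfolding \<psi>_def using x m by (intro local_rule) (auto simp: mem_seq_space funpow_shift)
    finally show ?thesis .
  qed
  moreover have "k \<ge> 1" by (simp add: k_def)
  ultimately show thesis using that by blast
qed

section \<open>Existence of Markov measures\<close>

text \<open>Draw independently, for each time \<open>n\<close> and each state \<open>s\<close>, the state to which the chain would move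
  at time \<open>n\<close> if it came from \<open>s\<close>; then follow these instructions. This reduces the construction
  to an infinite product of probability measures. The event that the chain follows a word \<open>w\<close>
  says that finitely many, pairwise distinct, instructions have prescribed values, so that its
  probability is the product of the transition probabilities. The initial letter is the move from
  an additional state \<open>m\<close> at time 0.\<close>

lemma markov_measure_exists:
  fixes p :: "nat \<Rightarrow> real" and P :: "nat \<Rightarrow> nat \<Rightarrow> real"
  assumes p: "\<And>i. i < m \<Longrightarrow> 0 \<le> p i" "(\<Sum>i<m. p i) = 1"
    and P: "\<And>i j. i < m \<Longrightarrow> j < m \<Longrightarrow> 0 \<le> P i j" "\<And>i. i < m \<Longrightarrow> (\<Sum>j<m. P i j) = 1"
  obtains \<mu> where "prob_measure_on_seq m \<mu>"
    and "\<And>w. w \<in> words m \<Longrightarrow> measure \<mu> (cylinder m w) =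
           p (w ! 0) * (\<Prod>k<length w - 1. P (w ! k) (w ! Suc k))"
proof -
  define row where "row s = (if s < m then P s else p)" for s
  have row: "\<And>s i. i < m \<Longrightarrow> 0 \<le> row s i" "\<And>s. (\<Sum>i<m. row s i) = 1"
    using p P by (auto simp: row_def)
  define N where "N z = point_measure {..<m} (\<lambda>i. ennreal (row (snd z) i))" for z :: "nat \<times> nat"
  have space_N: "space (N z) = {..<m}" and sets_N: "sets (N z) = Pow {..<m}" for z
    by (auto simp: N_def space_point_measure sets_point_measure)
  have emeasure_N: "emeasure (N z) A = (\<Sum>i\<in>A. ennreal (row (snd z) i))" if "A \<subseteq> {..<m}" for z A
    unfolding N_def using that by (intro emeasure_point_measure_finite) auto
  have "prob_space (N z)" for z
  proof (rule prob_spaceI)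
    have "emeasure (N z) (space (N z)) = (\<Sum>i<m. ennreal (row (snd z) i))"
      by (simp add: space_N emeasure_N)
    also have "\<dots> = ennreal (\<Sum>i<m. row (snd z) i)"
      using row(1) by (intro sum_ennreal) auto
    finally show "emeasure (N z) (space (N z)) = 1"
      by (simp add: row(2))
  qed
  then interpret Q: product_prob_space N UNIV
    by (rule product_prob_spaceI)
  let ?Q = "Pi\<^sub>M UNIV N"
  define X where "X \<omega> n = rec_nat (\<omega> (0, m)) (\<lambda>k y. \<omega> (Suc k, y)) n" for \<omega> :: "nat \<times> nat \<Rightarrow> nat" and n
  have X0: "X \<omega> 0 = \<omega> (0, m)" and XSuc: "X \<omega> (Suc n) = \<omega> (Suc n, X \<omega> n)" for \<omega> n
    by (simp_all add: X_def)
  have space_Q: "\<omega> z < m" if "\<omega> \<in> space ?Q" for \<omega> z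
    using that by (cases z) (auto simp: space_PiM PiE_iff space_N)
  have X_less: "X \<omega> n < m" if "\<omega> \<in> space ?Q" for \<omega> n
    using space_Q[OF that] by (cases n) (simp_all add: X0 XSuc)
  define J where "J w = (\<lambda>k. (k, (m # w) ! k)) ` {..<length w}" for w
  have event: "X -` cylinder m w \<inter> space ?Q = {\<omega> \<in> space ?Q. \<forall>z\<in>J w. \<omega> z \<in> {w ! fst z}}" for w
  proof -
    have "(\<forall>k<length w. X \<omega> k = w ! k) \<longleftrightarrow> (\<forall>k<length w. \<omega> (k, (m # w) ! k) = w ! k)" for \<omega>
    proof (intro iffI allI impI)
      fix k assume *: "\<forall>k<length w. X \<omega> k = w ! k" "k < length w"
      then show "\<omega> (k, (m # w) ! k) = w ! k"
        by (cases k) (metis X0 nth_Cons_0, metis XSuc Suc_lessD nth_Cons_Suc)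
    next
      fix k assume *: "\<forall>k<length w. \<omega> (k, (m # w) ! k) = w ! k" "k < length w"
      show "X \<omega> k = w ! k"
        using *(2)
      proof (induction k)
        case 0
        with *(1) show ?case by (auto simp: X0)
      next
        case (Suc k)
        then have "X \<omega> (Suc k) = \<omega> (Suc k, (m # w) ! Suc k)" by (simp add: XSuc)
        with *(1) Suc.prems show ?case by metis
      qed
    qed
    then show ?thesis
      using X_less by (auto simp: mem_cylinder J_def)
  qed
  have finJ: "finite (J w)" for w by (simp add: J_def)
  have events: "X -` cylinder m w \<inter> space ?Q \<in> sets ?Q" for w
  proof (cases "set w \<subseteq> {..<m}")
    case True
    have "{\<omega> \<in> space ?Q. \<omega> z \<in> {w ! fst z}} \<in> sets ?Q" if "z \<in> J w" for z
      using that True by (intro sets_Collect_single') (auto simp: J_def space_N sets_N)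
    then show ?thesis
      unfolding event by (intro sets.sets_Collect_finite_All[OF _ finJ])
  qed (simp add: cylinder_eq_empty)
  have meas: "X \<in> measurable ?Q (seq_borel m)"
    using X_less events by (intro measurable_seq_borelI) (auto simp: mem_seq_space)
  show thesis
  proof (rule that)
    show "prob_measure_on_seq m (distr ?Q (seq_borel m) X)"
      by (rule prob_measure_on_seq_distr[OF _ meas]) unfold_locales
    fix w assume w: "w \<in> words m"
    then obtain a v where av: "w = a # v" by (cases w) (auto simp: words_def)
    have w_less: "w ! k < m" if "k < length w" for k
      using w that by (auto simp: words_def subset_eq)
    let ?f = "\<lambda>k. row ((m # w) ! k) (w ! k)"
    have "emeasure (distr ?Q (seq_borel m) X) (cylinder m w) =
        emeasure ?Q {\<omega> \<in> space ?Q. \<forall>z\<in>J w. \<omega> z \<in> {w ! fst z}}"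
      by (subst emeasure_distr[OF meas]) (auto simp: sets_seq_borel event)
    also have "\<dots> = (\<Prod>z\<in>J w. emeasure (N z) {w ! fst z})"
      using finJ w_less by (intro Q.emeasure_PiM_Collect) (auto simp: J_def sets_N)
    also have "\<dots> = (\<Prod>k<length w. ennreal (?f k))"
      unfolding J_def using w_less by (subst prod.reindex) (auto simp: inj_on_def emeasure_N)
    also have "\<dots> = ennreal (\<Prod>k<length w. ?f k)"
      using w_less row by (intro prod_ennreal) auto
    finally have "measure (distr ?Q (seq_borel m) X) (cylinder m w) = enn2real (ennreal (\<Prod>k<length w. ?f k))"
      unfolding Sigma_Algebra.measure_def by (rule arg_cong)
    also have "\<dots> = (\<Prod>k<length w. ?f k)"
      using w_less row by (intro enn2real_ennreal prod_nonneg) auto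
    also have "\<dots> = p (w ! 0) * (\<Prod>k<length w - 1. P (w ! k) (w ! Suc k))"
    proof -
      have "(\<Prod>k<length w. ?f k) = ?f 0 * (\<Prod>k<length v. ?f (Suc k))"
        by (simp add: av prod.lessThan_Suc_shift del: prod.lessThan_Suc)
      also have "(\<Prod>k<length v. ?f (Suc k)) = (\<Prod>k<length v. P (w ! k) (w ! Suc k))"
        using w_less by (intro prod.cong) (auto simp: row_def av)
      finally show ?thesis by (simp add: row_def av)
    qed
    finally show "measure (distr ?Q (seq_borel m) X) (cylinder m w) =
        p (w ! 0) * (\<Prod>k<length w - 1. P (w ! k) (w ! Suc k))" .
  qed
qed

section \<open>Block images of Markov measures\<close>

text \<open>The product formula for a Markov measure with the initial vector eliminated: what remains is how
  the measure of a cylinder changes when its word grows by one letter.\<close>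

definition has_transitions :: "nat \<Rightarrow> (nat \<Rightarrow> nat \<Rightarrow> real) \<Rightarrow> (nat \<Rightarrow> nat) measure \<Rightarrow> bool" where
  "has_transitions m P \<mu> \<longleftrightarrow> (\<forall>u\<in>words m. \<forall>c<m.
     measure \<mu> (cylinder m (u @ [c])) = measure \<mu> (cylinder m u) * P (last u) c)"

definition blocks :: "nat \<Rightarrow> nat \<Rightarrow> nat list set" where
  "blocks m k = {u. set u \<subseteq> {..<m} \<and> length u = k}"

lemma finite_blocks: "finite (blocks m k)"
  unfolding blocks_def by (rule finite_lists_length_eq) simp

text \<open>The conditional probability, given that the last block read is \<open>s\<close>, that the next blocks of the
  Markov chain are mapped by \<open>\<psi>\<close> to the successive letters of \<open>w\<close>.\<close>

fun future_weight ::
  "nat \<Rightarrow> (nat \<Rightarrow> nat \<Rightarrow> real) \<Rightarrow> (nat list \<Rightarrow> nat) \<Rightarrow> nat list \<Rightarrow> nat list \<Rightarrow> real" where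
  "future_weight m P \<psi> [] s = 1"
| "future_weight m P \<psi> (a # w) s =
     (\<Sum>c<m. if \<psi> (tl s @ [c]) = a then P (last s) c * future_weight m P \<psi> w (tl s @ [c]) else 0)"

text \<open>The last block of the word \<open>v @ s\<close> is \<open>s\<close>, starting at time \<open>length v\<close>; the letters of \<open>w\<close> are
  the images of the blocks that start strictly later.\<close>

definition future_event ::
  "nat \<Rightarrow> (nat list \<Rightarrow> nat) \<Rightarrow> nat list \<Rightarrow> nat list \<Rightarrow> nat list \<Rightarrow> (nat \<Rightarrow> nat) set" where
  "future_event m \<psi> v s w = {x \<in> cylinder m (v @ s). \<forall>i<length w.
     \<psi> (map x [length v + Suc i..<length v + Suc i + length s]) = w ! i}"

lemma prefix_eq_block: "x \<in> cylinder m u \<Longrightarrow> u \<in> blocks m k \<Longrightarrow> map x [0..<k] = u"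
  by (rule nth_equalityI) (simp_all add: mem_cylinder blocks_def)

lemma mem_cylinder_snoc:
  "x \<in> cylinder m (u @ [c]) \<longleftrightarrow> x \<in> cylinder m u \<and> x (length u) = c"
  by (auto simp: mem_cylinder nth_append less_Suc_eq)

text \<open>Splitting according to the next letter \<open>c\<close> of the sequence: the block that determines \<open>a\<close> is then
  \<open>tl s @ [c]\<close>, and the remaining condition has the same form after one more step.\<close>

lemma future_event_Cons:
  assumes s: "s \<noteq> []"
  shows "future_event m \<psi> v s (a # w) =
    (\<Union>c\<in>{c \<in> {..<m}. \<psi> (tl s @ [c]) = a}. future_event m \<psi> (v @ [hd s]) (tl s @ [c]) w)"
proof -
  have eq: "(v @ [hd s]) @ (tl s @ [c]) = (v @ s) @ [c]" for c
    using s by simp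
  have len: "length (tl s @ [c]) = length s" for c
    using s by simp
  have block: "map x [Suc (length v)..<Suc (length v) + length s] = tl s @ [x (length v + length s)]"
    if "x \<in> cylinder m (v @ s)" for x
  proof (rule nth_equalityI)
    fix i assume "i < length (map x [Suc (length v)..<Suc (length v) + length s])"
    then have i: "i < length s" by (simp del: upt_Suc)
    show "map x [Suc (length v)..<Suc (length v) + length s] ! i =
        (tl s @ [x (length v + length s)]) ! i"
    proof (cases "Suc i < length s")
      case True
      then have "x (Suc (length v) + i) = s ! Suc i"
        using \<open>x \<in> cylinder m (v @ s)\<close>
        by (auto simp: mem_cylinder nth_append dest!: spec[of _ "Suc (length v) + i"])
      moreover have "i < length s - Suc 0" using True by linarith
      ultimately show ?thesis by (simp add: nth_append nth_tl del: upt_Suc)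
    next
      case False
      with i have "length s = Suc i" by simp
      then show ?thesis by (simp add: nth_append del: upt_Suc)
    qed
  qed (use s in \<open>simp del: upt_Suc\<close>)
  let ?rest = "\<lambda>x. \<forall>i<length w.
    \<psi> (map x [length v + Suc (Suc i)..<length v + Suc (Suc i) + length s]) = w ! i"
  have L: "x \<in> future_event m \<psi> v s (a # w) \<longleftrightarrow> x \<in> cylinder m (v @ s) \<and>
      \<psi> (map x [Suc (length v)..<Suc (length v) + length s]) = a \<and> ?rest x" for x
    by (simp add: future_event_def All_less_Suc2 del: upt_Suc)
  have R: "x \<in> future_event m \<psi> (v @ [hd s]) (tl s @ [c]) w \<longleftrightarrow>
      x \<in> cylinder m (v @ s) \<and> x (length v + length s) = c \<and> ?rest x" for x c
    unfolding future_event_def eq len mem_cylinder_snoc mem_Collect_eq by (simp del: upt_Suc)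
  show ?thesis
  proof (intro equalityI subsetI)
    fix x assume "x \<in> future_event m \<psi> v s (a # w)"
    then have x: "x \<in> cylinder m (v @ s)" "?rest x"
      and a: "\<psi> (map x [Suc (length v)..<Suc (length v) + length s]) = a"
      unfolding L by blast+
    let ?c = "x (length v + length s)"
    have "?c < m" using x(1) by (simp add: mem_cylinder)
    moreover have "\<psi> (tl s @ [?c]) = a" using a unfolding block[OF x(1)] .
    moreover have "x \<in> future_event m \<psi> (v @ [hd s]) (tl s @ [?c]) w"
      unfolding R using x by blast
    ultimately show "x \<in> (\<Union>c\<in>{c \<in> {..<m}. \<psi> (tl s @ [c]) = a}.
        future_event m \<psi> (v @ [hd s]) (tl s @ [c]) w)" by blast
  next
    fix x assume "x \<in> (\<Union>c\<in>{c \<in> {..<m}. \<psi> (tl s @ [c]) = a}.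
        future_event m \<psi> (v @ [hd s]) (tl s @ [c]) w)"
    then obtain c where c: "\<psi> (tl s @ [c]) = a"
      and "x \<in> future_event m \<psi> (v @ [hd s]) (tl s @ [c]) w" by blast
    then have x: "x \<in> cylinder m (v @ s)" "x (length v + length s) = c" "?rest x"
      unfolding R by blast+
    have "\<psi> (map x [Suc (length v)..<Suc (length v) + length s]) = a"
      unfolding block[OF x(1)] x(2) by (rule c)
    with x show "x \<in> future_event m \<psi> v s (a # w)"
      unfolding L by blast
  qed
qed

text \<open>The events for different next letters are disjoint, and the Markov property multiplies the
  measure of the cylinder by a factor that depends on \<open>s\<close> and \<open>c\<close> only; so the recursion
  of the events matches that of the weights.\<close>

lemma measure_future_event:
  assumes \<mu>: "prob_measure_on_seq m \<mu>"
    and P: "has_transitions m P \<mu>"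
    and s: "s \<noteq> []" "set (v @ s) \<subseteq> {..<m}"
  shows "future_event m \<psi> v s w \<in> sets \<mu> \<and>
    measure \<mu> (future_event m \<psi> v s w) = measure \<mu> (cylinder m (v @ s)) * future_weight m P \<psi> w s"
  using s
proof (induction w arbitrary: v s)
  case Nil
  then show ?case by (simp add: future_event_def cylinder_in_sets[OF \<mu>])
next
  case (Cons a w)
  interpret prob_space \<mu> by (rule prob_measure_on_seqD[OF \<mu>])
  let ?C = "{c \<in> {..<m}. \<psi> (tl s @ [c]) = a}"
  let ?E = "\<lambda>c. future_event m \<psi> (v @ [hd s]) (tl s @ [c]) w"
  have eq: "(v @ [hd s]) @ (tl s @ [c]) = (v @ s) @ [c]" for c
    using Cons.prems by simp
  have IH: "?E c \<in> sets \<mu>"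
      "measure \<mu> (?E c) = measure \<mu> (cylinder m (v @ s)) * (P (last s) c * future_weight m P \<psi> w (tl s @ [c]))"
    if "c \<in> ?C" for c
  proof -
    have "set ((v @ [hd s]) @ (tl s @ [c])) \<subseteq> {..<m}"
      using Cons.prems(2) that unfolding eq by simp
    moreover have "tl s @ [c] \<noteq> []" by simp
    ultimately have IH: "?E c \<in> sets \<mu>" "measure \<mu> (?E c) =
        measure \<mu> (cylinder m ((v @ [hd s]) @ (tl s @ [c]))) * future_weight m P \<psi> w (tl s @ [c])"
      using Cons.IH by blast+
    show "?E c \<in> sets \<mu>" by (rule IH(1))
    have "measure \<mu> (?E c) = measure \<mu> (cylinder m ((v @ s) @ [c])) * future_weight m P \<psi> w (tl s @ [c])"
      using IH(2) unfolding eq .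
    also have "measure \<mu> (cylinder m ((v @ s) @ [c])) = measure \<mu> (cylinder m (v @ s)) * P (last s) c"
    proof -
      have "v @ s \<in> words m" using Cons.prems by (simp add: words_def)
      then have "measure \<mu> (cylinder m ((v @ s) @ [c])) =
          measure \<mu> (cylinder m (v @ s)) * P (last (v @ s)) c"
        using P that unfolding has_transitions_def by blast
      also have "last (v @ s) = last s" using Cons.prems by simp
      finally show ?thesis .
    qed
    finally show "measure \<mu> (?E c) =
        measure \<mu> (cylinder m (v @ s)) * (P (last s) c * future_weight m P \<psi> w (tl s @ [c]))"
      by (simp only: mult.assoc)
  qed
  have disj: "disjoint_family_on ?E ?C"
  proof -
    have "x (length (v @ s)) = c" if "x \<in> ?E c" for x c
      using that unfolding future_event_def eq mem_cylinder_snoc by simp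
    then show ?thesis
      unfolding disjoint_family_on_def by (intro ballI impI) blast
  qed
  have union: "future_event m \<psi> v s (a # w) = (\<Union>c\<in>?C. ?E c)"
    by (rule future_event_Cons[OF Cons.prems(1)])
  have "measure \<mu> (future_event m \<psi> v s (a # w)) = (\<Sum>c\<in>?C. measure \<mu> (?E c))"
    unfolding union
  proof (rule finite_measure_finite_Union)
    show "?E ` ?C \<subseteq> sets \<mu>" using IH(1) by blast
    show "disjoint_family_on ?E ?C" by (rule disj)
  qed simp
  also have "\<dots> = measure \<mu> (cylinder m (v @ s)) *
      (\<Sum>c\<in>?C. P (last s) c * future_weight m P \<psi> w (tl s @ [c]))"
    unfolding sum_distrib_left by (rule sum.cong[OF refl IH(2)])
  also have "(\<Sum>c\<in>?C. P (last s) c * future_weight m P \<psi> w (tl s @ [c])) = future_weight m P \<psi> (a # w) s"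
    unfolding future_weight.simps by (rule sum.inter_filter) simp
  finally have "measure \<mu> (future_event m \<psi> v s (a # w)) =
      measure \<mu> (cylinder m (v @ s)) * future_weight m P \<psi> (a # w) s" .
  moreover have "future_event m \<psi> v s (a # w) \<in> sets \<mu>"
    unfolding union by (rule sets.finite_UN) (simp, rule IH(1))
  ultimately show ?case by blast
qed

lemma measure_block_event:
  assumes \<mu>: "prob_measure_on_seq m \<mu>" and k: "k \<ge> 1"
    and P: "has_transitions m P \<mu>"
  shows "measure \<mu> {x \<in> space \<mu>. \<forall>i<length (a # w). \<psi> (map x [i..<i + k]) = (a # w) ! i} =
    (\<Sum>u\<in>blocks m k. if \<psi> u = a then measure \<mu> (cylinder m u) * future_weight m P \<psi> w u else 0)"
proof -
  interpret prob_space \<mu> by (rule prob_measure_on_seqD[OF \<mu>])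
  let ?B = "{u \<in> blocks m k. \<psi> u = a}"
  have ev: "future_event m \<psi> [] u w \<in> sets \<mu>"
      "measure \<mu> (future_event m \<psi> [] u w) = measure \<mu> (cylinder m u) * future_weight m P \<psi> w u"
    if "u \<in> ?B" for u
  proof -
    have "u \<noteq> []" "set ([] @ u) \<subseteq> {..<m}"
      using that k by (auto simp: blocks_def)
    from measure_future_event[OF \<mu> P this]
    show "future_event m \<psi> [] u w \<in> sets \<mu>"
      "measure \<mu> (future_event m \<psi> [] u w) = measure \<mu> (cylinder m u) * future_weight m P \<psi> w u"
      by simp_all
  qed
  let ?rest = "\<lambda>x. \<forall>i<length w. \<psi> (map x [Suc i..<Suc i + k]) = w ! i"
  have L: "(\<forall>i<length (a # w). \<psi> (map x [i..<i + k]) = (a # w) ! i) \<longleftrightarrow>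
      \<psi> (map x [0..<k]) = a \<and> ?rest x" for x
    by (simp add: All_less_Suc2 del: upt_Suc)
  have R: "x \<in> future_event m \<psi> [] u w \<longleftrightarrow> x \<in> cylinder m u \<and> ?rest x" if "u \<in> ?B" for x u
    using that by (simp add: future_event_def blocks_def del: upt_Suc)
  have "{x \<in> space \<mu>. \<forall>i<length (a # w). \<psi> (map x [i..<i + k]) = (a # w) ! i} =
      (\<Union>u\<in>?B. future_event m \<psi> [] u w)"
  proof (intro equalityI subsetI)
    fix x assume "x \<in> {x \<in> space \<mu>. \<forall>i<length (a # w). \<psi> (map x [i..<i + k]) = (a # w) ! i}"
    then have x: "x \<in> space \<mu>" "\<psi> (map x [0..<k]) = a" "?rest x"
      unfolding mem_Collect_eq L by blast+
    then have B: "map x [0..<k] \<in> ?B" and "x \<in> cylinder m (map x [0..<k])"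
      by (auto simp: blocks_def mem_cylinder mem_seq_space prob_measure_on_seqD[OF \<mu>])
    then show "x \<in> (\<Union>u\<in>?B. future_event m \<psi> [] u w)"
      using x R[OF B] by blast
  next
    fix x assume "x \<in> (\<Union>u\<in>?B. future_event m \<psi> [] u w)"
    then obtain u where u: "u \<in> ?B" "x \<in> future_event m \<psi> [] u w" by blast
    then have x: "x \<in> cylinder m u" "?rest x" using R by blast+
    have "map x [0..<k] = u" using prefix_eq_block[OF x(1)] u(1) by blast
    moreover have "x \<in> space \<mu>"
      using x(1) cylinder_subset prob_measure_on_seqD(3)[OF \<mu>] by blast
    ultimately show "x \<in> {x \<in> space \<mu>. \<forall>i<length (a # w). \<psi> (map x [i..<i + k]) = (a # w) ! i}"
      unfolding mem_Collect_eq L using x(2) u(1) by blast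
  qed
  then have "measure \<mu> {x \<in> space \<mu>. \<forall>i<length (a # w). \<psi> (map x [i..<i + k]) = (a # w) ! i} =
      measure \<mu> (\<Union>u\<in>?B. future_event m \<psi> [] u w)" by (rule arg_cong)
  also have "\<dots> = (\<Sum>u\<in>?B. measure \<mu> (future_event m \<psi> [] u w))"
  proof (rule finite_measure_finite_Union)
    show "(\<lambda>u. future_event m \<psi> [] u w) ` ?B \<subseteq> sets \<mu>"
      using ev by blast
    have "map x [0..<k] = u" if "u \<in> ?B" "x \<in> future_event m \<psi> [] u w" for u x
      using that R prefix_eq_block by blast
    then show "disjoint_family_on (\<lambda>u. future_event m \<psi> [] u w) ?B"
      unfolding disjoint_family_on_def by blast
  qed (simp add: finite_blocks)
  also have "\<dots> = (\<Sum>u\<in>?B. measure \<mu> (cylinder m u) * future_weight m P \<psi> w u)"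
    using ev by (intro sum.cong) auto
  also have "\<dots> = (\<Sum>u\<in>blocks m k. if \<psi> u = a then measure \<mu> (cylinder m u) * future_weight m P \<psi> w u else 0)"
    by (rule sum.inter_filter[OF finite_blocks])
  finally show ?thesis .
qed

lemma sum_cylinder_blocks:
  assumes "prob_measure_on_seq m \<mu>"
  shows "(\<Sum>u\<in>blocks m k. measure \<mu> (cylinder m u)) = 1"
proof -
  interpret prob_space \<mu> by (rule prob_measure_on_seqD[OF assms])
  have "disjoint_family_on (cylinder m) (blocks m k)"
  proof -
    have "u = map x [0..<k]" if "u \<in> blocks m k" "x \<in> cylinder m u" for u x
      using prefix_eq_block[OF that(2,1)] by (rule sym)
    then show ?thesis
      unfolding disjoint_family_on_def by blast
  qed
  then have "(\<Sum>u\<in>blocks m k. measure \<mu> (cylinder m u)) = measure \<mu> (\<Union>u\<in>blocks m k. cylinder m u)"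
    using cylinder_in_sets[OF assms] by (intro finite_measure_finite_Union[symmetric] finite_blocks) auto
  also have "(\<Union>u\<in>blocks m k. cylinder m u) = space \<mu>"
  proof (intro equalityI subsetI)
    fix x assume "x \<in> space \<mu>"
    then have "map x [0..<k] \<in> blocks m k" "x \<in> cylinder m (map x [0..<k])"
      by (auto simp: prob_measure_on_seqD[OF assms] mem_seq_space blocks_def mem_cylinder)
    then show "x \<in> (\<Union>u\<in>blocks m k. cylinder m u)" by blast
  qed (auto simp: prob_measure_on_seqD[OF assms] cylinder_def)
  finally show ?thesis by (simp add: prob_space)
qed

lemma markov_has_transitions:
  fixes p :: "nat \<Rightarrow> real"
  assumes "\<forall>w\<in>words m. measure \<mu> (cylinder m w) =
      p (w ! 0) * (\<Prod>k<length w - 1. P (w ! k) (w ! Suc k))"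
  shows "has_transitions m P \<mu>"
  unfolding has_transitions_def
proof (intro ballI allI impI)
  fix u c assume u: "u \<in> words m" and c: "c < m"
  let ?g = "\<lambda>w k. P (w ! k) (w ! Suc k)"
  obtain n where n: "length u = Suc n"
    using u by (cases u) (auto simp: words_def)
  have "u @ [c] \<in> words m" using u c by (auto simp: words_def)
  then have "measure \<mu> (cylinder m (u @ [c])) = p ((u @ [c]) ! 0) * (\<Prod>k<Suc n. ?g (u @ [c]) k)"
    using assms(1) n by simp
  also have "(\<Prod>k<Suc n. ?g (u @ [c]) k) = (\<Prod>k<n. ?g u k) * P (last u) c"
  proof -
    have "last u = u ! n" using n last_conv_nth[of u] by fastforce
    then show ?thesis using n by (simp add: nth_append)
  qed
  finally show "measure \<mu> (cylinder m (u @ [c])) = measure \<mu> (cylinder m u) * P (last u) c"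
    using assms u n by (simp add: nth_append)
qed

lemma measure_distr_cylinder:
  assumes \<phi>: "\<phi> \<in> measurable \<mu> (seq_borel b)"
    and block: "\<And>x i. x \<in> space \<mu> \<Longrightarrow> \<phi> x i = \<psi> (map x [i..<i + k])"
  shows "measure (distr \<mu> (seq_borel b) \<phi>) (cylinder b w) =
    measure \<mu> {x \<in> space \<mu>. \<forall>i<length w. \<psi> (map x [i..<i + k]) = w ! i}"
proof -
  have "\<phi> x \<in> topspace (seq_space b)" if "x \<in> space \<mu>" for x
    using measurable_space[OF \<phi> that] by (simp add: space_seq_borel)
  then have "\<phi> -` cylinder b w \<inter> space \<mu> = {x \<in> space \<mu>. \<forall>i<length w. \<psi> (map x [i..<i + k]) = w ! i}"
    using block by (auto simp: cylinder_def)
  then show ?thesis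
    by (subst measure_distr[OF \<phi>]) (auto simp: sets_seq_borel)
qed

section \<open>Linear representations over finite index sets\<close>

text \<open>The entry with index \<open>s\<close> of the column vector \<open>M\<^bsub>a\<^sub>1\<^esub> \<cdots> M\<^bsub>a\<^sub>n\<^esub> C\<close>, where \<open>w = a\<^sub>1\<dots>a\<^sub>n\<close>, with an
  arbitrary finite set in place of \<open>{..<r}\<close> for the indices. In this form the index set
  can consist of blocks, without numbering them.\<close>

fun path_weight ::
  "'a set \<Rightarrow> (nat \<Rightarrow> 'a \<Rightarrow> 'a \<Rightarrow> real) \<Rightarrow> ('a \<Rightarrow> real) \<Rightarrow> nat list \<Rightarrow> 'a \<Rightarrow> real" where
  "path_weight S M C [] s = C s"
| "path_weight S M C (a # w) s = (\<Sum>t\<in>S. M a s t * path_weight S M C w t)"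

definition represents :: "nat \<Rightarrow> (nat \<Rightarrow> nat) measure \<Rightarrow> 'a set \<Rightarrow> (nat \<Rightarrow> 'a \<Rightarrow> real) \<Rightarrow>
    (nat \<Rightarrow> 'a \<Rightarrow> 'a \<Rightarrow> real) \<Rightarrow> ('a \<Rightarrow> real) \<Rightarrow> bool" where
  "represents b \<eta> S R M C \<longleftrightarrow>
     (\<forall>a<b. \<forall>s\<in>S. 0 \<le> R a s) \<and> (\<forall>a<b. \<forall>s\<in>S. \<forall>t\<in>S. 0 \<le> M a s t) \<and> (\<forall>s\<in>S. 0 < C s) \<and>
     (\<Sum>s\<in>S. (\<Sum>a<b. R a s) * C s) = 1 \<and>
     (\<forall>s\<in>S. (\<Sum>t\<in>S. (\<Sum>a<b. M a s t) * C t) = C s) \<and>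
     (\<forall>a w. a # w \<in> words b \<longrightarrow>
        measure \<eta> (cylinder b (a # w)) = (\<Sum>s\<in>S. R a s * path_weight S M C w s))"

lemma path_weight_reindex:
  assumes "bij_betw h T S"
  shows "path_weight T (\<lambda>a i j. M a (h i) (h j)) (\<lambda>i. C (h i)) w i = path_weight S M C w (h i)"
proof (induction w arbitrary: i)
  case (Cons a w)
  show ?case
    by (simp add: Cons.IH sum.reindex_bij_betw[OF assms, of "\<lambda>t. M a (h i) t * path_weight S M C w t"])
qed simp

lemma represents_reindex:
  assumes h: "bij_betw h T S" and rep: "represents b \<eta> S R M C"
  shows "represents b \<eta> T (\<lambda>a i. R a (h i)) (\<lambda>a i j. M a (h i) (h j)) (\<lambda>i. C (h i))"
proof -
  have hT: "h i \<in> S" if "i \<in> T" for i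
    using bij_betwE[OF h] that by blast
  show ?thesis
    using rep hT
    unfolding represents_def path_weight_reindex[OF h]
      sum.reindex_bij_betw[OF h, of "\<lambda>s. (\<Sum>a<b. R a s) * C s"]
      sum.reindex_bij_betw[OF h, of "\<lambda>t. (\<Sum>a<b. M a s t) * C t" for s]
      sum.reindex_bij_betw[OF h, of "\<lambda>s. R a s * path_weight S M C w s" for a w]
    by blast
qed

lemma foldr_mult_mat_vec:
  fixes A :: "nat \<Rightarrow> real Matrix.mat" and C :: "real Matrix.vec"
  assumes "\<forall>a\<in>set w. A a \<in> carrier_mat r r" and C: "C \<in> carrier_vec r"
  shows "foldr (\<lambda>a B. A a * B) w (1\<^sub>m r) \<in> carrier_mat r r"
    and "j < r \<Longrightarrow> (foldr (\<lambda>a B. A a * B) w (1\<^sub>m r) *\<^sub>v C) $ j =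
      path_weight {..<r} (\<lambda>a i j. A a $$ (i, j)) (\<lambda>i. C $ i) w j"
proof -
  have "foldr (\<lambda>a B. A a * B) w (1\<^sub>m r) \<in> carrier_mat r r \<and>
    (\<forall>j<r. (foldr (\<lambda>a B. A a * B) w (1\<^sub>m r) *\<^sub>v C) $ j =
      path_weight {..<r} (\<lambda>a i j. A a $$ (i, j)) (\<lambda>i. C $ i) w j)"
    using assms(1)
  proof (induction w)
    case Nil
    show ?case using C by simp
  next
    case (Cons a w)
    let ?B = "foldr (\<lambda>a B. A a * B) w (1\<^sub>m r)"
    have A: "A a \<in> carrier_mat r r" and B: "?B \<in> carrier_mat r r"
      and IH: "\<And>j. j < r \<Longrightarrow> (?B *\<^sub>v C) $ j =
        path_weight {..<r} (\<lambda>a i j. A a $$ (i, j)) (\<lambda>i. C $ i) w j"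
      using Cons by auto
    have dim: "dim_vec (?B *\<^sub>v C) = r" using B by auto
    have "((A a * ?B) *\<^sub>v C) $ j = (\<Sum>i<r. A a $$ (j, i) * (?B *\<^sub>v C) $ i)" if "j < r" for j
    proof -
      have "(A a * ?B) *\<^sub>v C = A a *\<^sub>v (?B *\<^sub>v C)"
        by (rule assoc_mult_mat_vec[OF A B C])
      also have "\<dots> $ j = Matrix.row (A a) j \<bullet> (?B *\<^sub>v C)"
        using A that by (intro index_mult_mat_vec) auto
      also have "\<dots> = (\<Sum>i<r. A a $$ (j, i) * (?B *\<^sub>v C) $ i)"
        unfolding scalar_prod_def dim atLeast0LessThan
        using A that by (intro sum.cong) auto
      finally show ?thesis .
    qed
    with A B IH show ?case by simp
  qed
  then show "foldr (\<lambda>a B. A a * B) w (1\<^sub>m r) \<in> carrier_mat r r"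
    and "j < r \<Longrightarrow> (foldr (\<lambda>a B. A a * B) w (1\<^sub>m r) *\<^sub>v C) $ j =
      path_weight {..<r} (\<lambda>a i j. A a $$ (i, j)) (\<lambda>i. C $ i) w j"
    by blast+
qed

lemma matrix_rep_iff_represents:
  fixes R :: "nat \<Rightarrow> real Matrix.vec" and M :: "nat \<Rightarrow> real Matrix.mat" and C :: "real Matrix.vec"
  shows "((\<forall>i<b. R i \<in> carrier_vec r \<and> (\<forall>j<r. 0 \<le> R i $ j)) \<and>
        (\<forall>i<b. M i \<in> carrier_mat r r \<and> (\<forall>j<r. \<forall>k<r. 0 \<le> M i $$ (j, k))) \<and>
        C \<in> carrier_vec r \<and> (\<forall>j<r. 0 < C $ j) \<and>
        Matrix.vec r (\<lambda>j. \<Sum>i<b. R i $ j) \<bullet> C = 1 \<and>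
        Matrix.mat r r (\<lambda>(j, k). \<Sum>i<b. M i $$ (j, k)) *\<^sub>v C = C \<and>
        (\<forall>w\<in>words b. measure \<eta> (cylinder b w) =
           R (hd w) \<bullet> (foldr (\<lambda>a A. M a * A) (tl w) (1\<^sub>m r) *\<^sub>v C))) \<longleftrightarrow>
    ((\<forall>i<b. R i \<in> carrier_vec r) \<and> (\<forall>i<b. M i \<in> carrier_mat r r) \<and> C \<in> carrier_vec r) \<and>
    represents b \<eta> {..<r} (\<lambda>a i. R a $ i) (\<lambda>a i j. M a $$ (i, j)) (\<lambda>i. C $ i)"
    (is "?lhs \<longleftrightarrow> ?carriers \<and> ?rep")
proof (cases ?carriers)
  case False
  then show ?thesis by blast
next
  case True
  then have M: "\<forall>i<b. M i \<in> carrier_mat r r" and C: "C \<in> carrier_vec r" by blast+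
  have dimC: "dim_vec C = r" using C by auto
  have 1: "Matrix.vec r (\<lambda>j. \<Sum>i<b. R i $ j) \<bullet> C = (\<Sum>s<r. (\<Sum>a<b. R a $ s) * C $ s)"
    unfolding scalar_prod_def dimC atLeast0LessThan by (intro sum.cong) auto
  have 2: "Matrix.mat r r (\<lambda>(j, k). \<Sum>i<b. M i $$ (j, k)) *\<^sub>v C = C \<longleftrightarrow>
      (\<forall>s<r. (\<Sum>t<r. (\<Sum>a<b. M a $$ (s, t)) * C $ t) = C $ s)"
  proof -
    have "(Matrix.mat r r (\<lambda>(j, k). \<Sum>i<b. M i $$ (j, k)) *\<^sub>v C) $ s =
        (\<Sum>t<r. (\<Sum>a<b. M a $$ (s, t)) * C $ t)" if "s < r" for s
      using that by (simp add: scalar_prod_def dimC atLeast0LessThan)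
    then show ?thesis
      using dimC by (auto simp: vec_eq_iff)
  qed
  have 3: "R a \<bullet> (foldr (\<lambda>a A. M a * A) w (1\<^sub>m r) *\<^sub>v C) = (\<Sum>s<r. R a $ s *
      path_weight {..<r} (\<lambda>a i j. M a $$ (i, j)) (\<lambda>i. C $ i) w s)" if "a # w \<in> words b" for a w
  proof -
    have w: "\<forall>a\<in>set w. M a \<in> carrier_mat r r"
      using that M by (auto simp: words_def)
    have "dim_vec (foldr (\<lambda>a A. M a * A) w (1\<^sub>m r) *\<^sub>v C) = r"
      using foldr_mult_mat_vec(1)[OF w C] by auto
    then show ?thesis
      using foldr_mult_mat_vec(2)[OF w C]
      by (auto simp: scalar_prod_def atLeast0LessThan intro!: sum.cong)
  qed
  have 4: "(\<forall>w\<in>words b. Q w) \<longleftrightarrow> (\<forall>a w. a # w \<in> words b \<longrightarrow> Q (a # w))" for Q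
  proof (intro iffI ballI)
    fix w assume "\<forall>a w. a # w \<in> words b \<longrightarrow> Q (a # w)" "w \<in> words b"
    then show "Q w" by (cases w) (auto simp: words_def)
  qed blast
  show ?thesis
    unfolding represents_def 1 2 4 using True by (simp add: 3 Ball_def)
qed

lemma linearly_representable_iff:
  "linearly_representable b \<eta> \<longleftrightarrow> (\<exists>r\<ge>1. \<exists>R M C. represents b \<eta> {..<r::nat} R M C)"
proof
  assume "linearly_representable b \<eta>"
  then show "\<exists>r\<ge>1. \<exists>R M C. represents b \<eta> {..<r::nat} R M C"
    unfolding linearly_representable_def matrix_rep_iff_represents by blast
next
  assume "\<exists>r\<ge>1. \<exists>R M C. represents b \<eta> {..<r::nat} R M C"
  then obtain r R M C where r: "r \<ge> 1" and rep: "represents b \<eta> {..<r::nat} R M C" by blast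
  let ?R = "\<lambda>a. Matrix.vec r (R a)" and ?M = "\<lambda>a. Matrix.mat r r (\<lambda>(i, j). M a i j)"
    and ?C = "Matrix.vec r C"
  have pw: "path_weight {..<r} (\<lambda>a i j. ?M a $$ (i, j)) (\<lambda>i. ?C $ i) w s = path_weight {..<r} M C w s"
    if "s < r" for w s
    using that by (induction w arbitrary: s) auto
  have "represents b \<eta> {..<r} (\<lambda>a i. ?R a $ i) (\<lambda>a i j. ?M a $$ (i, j)) (\<lambda>i. ?C $ i)"
    using rep unfolding represents_def by (simp add: pw)
  then show "linearly_representable b \<eta>"
    unfolding linearly_representable_def matrix_rep_iff_represents
    using r by (intro exI[of _ r] conjI exI[of _ ?R] exI[of _ ?M] exI[of _ ?C]) simp_all
qed

lemma linearly_representableI: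
  assumes "finite S" "S \<noteq> {}" "represents b \<eta> S R M C"
  shows "linearly_representable b \<eta>"
proof -
  obtain h where "bij_betw h {..<card S} S"
    using ex_bij_betw_nat_finite[OF assms(1)] by (auto simp: atLeast0LessThan)
  moreover have "card S \<ge> 1"
    using assms by (simp add: Suc_le_eq card_gt_0_iff)
  ultimately show ?thesis
    unfolding linearly_representable_iff using represents_reindex assms(3) by blast
qed

section \<open>Sofic measures are linearly representable\<close>

lemma sofic_imp_linearly_representable:
  assumes "sofic b \<eta>"
  shows "linearly_representable b \<eta>"
proof -
  obtain m \<mu> \<phi> where m: "m \<ge> 1" and "markov_measure m \<mu>"
    and mor: "continuous_morphism m b \<phi>" and \<eta>: "\<eta> = distr \<mu> (seq_borel b) \<phi>"
    using assms by (auto simp: sofic_def)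
  then obtain p :: "nat \<Rightarrow> real" and P where \<mu>: "prob_measure_on_seq m \<mu>"
    and Pnn: "\<And>i j. i < m \<Longrightarrow> j < m \<Longrightarrow> 0 \<le> P i j" and Psum: "\<And>i. i < m \<Longrightarrow> (\<Sum>j<m. P i j) = 1"
    and cyl: "\<forall>w\<in>words m. measure \<mu> (cylinder m w) =
           p (w ! 0) * (\<Prod>k<length w - 1. P (w ! k) (w ! Suc k))"
    unfolding markov_measure_def by blast
  obtain k \<psi> where k: "k \<ge> 1"
    and block: "\<And>x i. x \<in> topspace (seq_space m) \<Longrightarrow> \<phi> x i = \<psi> (map x [i..<i + k])"
    using morphism_imp_block_map[OF mor m] by blast
  have \<phi>: "\<phi> \<in> measurable \<mu> (seq_borel b)"
    using mor \<mu> by (auto simp: continuous_morphism_def intro: morphism_measurable)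
  let ?S = "blocks m k"
  have \<psi>_less: "\<psi> u < b" if "u \<in> ?S" for u
  proof -
    let ?x = "\<lambda>i. if i < k then u ! i else 0"
    have x: "?x \<in> topspace (seq_space m)"
      using that m by (auto simp: blocks_def mem_seq_space subset_eq)
    have "map ?x [0..<0 + k] = u"
      using that by (intro nth_equalityI) (auto simp: blocks_def)
    then have "\<psi> u = \<phi> ?x 0" using block[OF x, of 0] by simp
    moreover have "\<phi> ?x \<in> topspace (seq_space b)"
      using measurable_space[OF \<phi>] x by (simp add: prob_measure_on_seqD[OF \<mu>] space_seq_borel)
    ultimately show ?thesis by (simp add: mem_seq_space)
  qed
  \<comment> \<open>\<open>T\<close> gives the transition probabilities between blocks; \<open>M\<^sub>a\<close> keeps those that enter a block coding \<open>a\<close>\<close>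
  define T where "T u v = (\<Sum>c<m. if v = tl u @ [c] then P (last u) c else 0)" for u v
  define R where "R a u = (if \<psi> u = a then measure \<mu> (cylinder m u) else 0)" for a u
  define M where "M a u v = (if \<psi> v = a then T u v else 0)" for a u v
  have succ: "tl u @ [c] \<in> ?S" "last u < m" if "u \<in> ?S" "c < m" for u c
  proof -
    have "u \<noteq> []" using that(1) k by (auto simp: blocks_def)
    then show "tl u @ [c] \<in> ?S" "last u < m"
      using that last_in_set[of u] list.set_sel(2)[of u] by (auto simp: blocks_def subset_eq)
  qed
  have T_sum: "(\<Sum>v\<in>?S. T u v * g v) = (\<Sum>c<m. P (last u) c * g (tl u @ [c]))"
    if "u \<in> ?S" for u g
  proof -
    have "(\<Sum>v\<in>?S. T u v * g v) = (\<Sum>c<m. \<Sum>v\<in>?S. if v = tl u @ [c] then P (last u) c * g v else 0)"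
      unfolding T_def sum_distrib_right by (subst sum.swap) (auto intro!: sum.cong)
    also have "\<dots> = (\<Sum>c<m. P (last u) c * g (tl u @ [c]))"
      using succ[OF that] by (intro sum.cong) (simp_all add: finite_blocks)
    finally show ?thesis .
  qed
  have pw: "path_weight ?S M (\<lambda>_. 1) w u = future_weight m P \<psi> w u" if "u \<in> ?S" for w u
    using that
  proof (induction w arbitrary: u)
    case (Cons a w)
    have "path_weight ?S M (\<lambda>_. 1) (a # w) u =
        (\<Sum>v\<in>?S. T u v * (if \<psi> v = a then future_weight m P \<psi> w v else 0))"
      unfolding path_weight.simps
    proof (rule sum.cong[OF refl])
      fix v assume "v \<in> ?S"
      then show "M a u v * path_weight ?S M (\<lambda>_. 1) w v =
          T u v * (if \<psi> v = a then future_weight m P \<psi> w v else 0)"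
        by (simp only: Cons.IH) (simp add: M_def)
    qed
    also have "\<dots> = future_weight m P \<psi> (a # w) u"
      using T_sum[OF Cons.prems] by (auto intro!: sum.cong)
    finally show ?case .
  qed simp
  have "represents b \<eta> ?S R M (\<lambda>_. 1)"
    unfolding represents_def
  proof (intro conjI allI impI ballI)
    show "0 \<le> R a u" for a u by (simp add: R_def)
    show "0 \<le> M a u v" if "u \<in> ?S" for a u v
      using succ[OF that] Pnn unfolding M_def T_def by (auto intro!: sum_nonneg)
    have "(\<Sum>u\<in>?S. (\<Sum>a<b. R a u) * 1) = (\<Sum>u\<in>?S. measure \<mu> (cylinder m u))"
      using \<psi>_less by (intro sum.cong) (auto simp: R_def)
    then show "(\<Sum>u\<in>?S. (\<Sum>a<b. R a u) * 1) = 1"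
      using sum_cylinder_blocks[OF \<mu>] by simp
    show "(\<Sum>v\<in>?S. (\<Sum>a<b. M a u v) * 1) = 1" if u: "u \<in> ?S" for u
    proof -
      have "(\<Sum>v\<in>?S. (\<Sum>a<b. M a u v) * 1) = (\<Sum>v\<in>?S. T u v * 1)"
        using \<psi>_less by (intro sum.cong) (auto simp: M_def)
      also have "\<dots> = 1"
        using T_sum[OF u, of "\<lambda>_. 1"] Psum succ(2)[OF u, of 0] m by simp
      finally show ?thesis .
    qed
    fix a w
    have "measure \<eta> (cylinder b (a # w)) =
        measure \<mu> {x \<in> space \<mu>. \<forall>i<length (a # w). \<psi> (map x [i..<i + k]) = (a # w) ! i}"
      unfolding \<eta> using block by (intro measure_distr_cylinder[OF \<phi>]) (simp add: prob_measure_on_seqD[OF \<mu>])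
    also have "\<dots> = (\<Sum>u\<in>?S. if \<psi> u = a then measure \<mu> (cylinder m u) * future_weight m P \<psi> w u else 0)"
      by (rule measure_block_event[OF \<mu> k markov_has_transitions[OF cyl]])
    also have "\<dots> = (\<Sum>u\<in>?S. R a u * path_weight ?S M (\<lambda>_. 1) w u)"
      by (intro sum.cong) (auto simp: R_def pw)
    finally show "measure \<eta> (cylinder b (a # w)) = (\<Sum>u\<in>?S. R a u * path_weight ?S M (\<lambda>_. 1) w u)" .
  qed auto
  moreover have "?S \<noteq> {}"
  proof -
    have "replicate k 0 \<in> ?S" using m by (auto simp: blocks_def)
    then show ?thesis by blast
  qed
  ultimately show ?thesis
    by (intro linearly_representableI[OF finite_blocks])
qed

section \<open>Linearly representable measures are sofic\<close>

lemma sum_div_mod: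
  fixes g :: "nat \<Rightarrow> nat \<Rightarrow> 'a::comm_monoid_add"
  shows "(\<Sum>t<b * r. g (t div r) (t mod r)) = (\<Sum>a<b. \<Sum>j<r. g a j)"
proof -
  have "(\<Sum>a<b. \<Sum>j<r. g a j) = (\<Sum>(a, j)\<in>{..<b} \<times> {..<r}. g a j)"
    by (rule sum.cartesian_product)
  also have "\<dots> = (\<Sum>t<b * r. g (t div r) (t mod r))"
  proof (rule sum.reindex_bij_witness[where i = "\<lambda>t. (t div r, t mod r)" and j = "\<lambda>(a, j). a * r + j"])
    fix x assume "x \<in> {..<b} \<times> {..<r}"
    then obtain a j where x: "x = (a, j)" "a < b" "j < r" by auto
    have "a * r + j < Suc a * r" using x by simp
    also have "\<dots> \<le> b * r" using x by (intro mult_right_mono) auto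
    finally show "(case x of (a, j) \<Rightarrow> a * r + j) \<in> {..<b * r}" by (simp add: x)
    show "g ((case x of (a, j) \<Rightarrow> a * r + j) div r) ((case x of (a, j) \<Rightarrow> a * r + j) mod r) =
        (case x of (a, j) \<Rightarrow> g a j)"
      using x by simp
    show "((case x of (a, j) \<Rightarrow> a * r + j) div r, (case x of (a, j) \<Rightarrow> a * r + j) mod r) = x"
      using x by simp
  next
    fix t assume "t \<in> {..<b * r}"
    then show "(t div r, t mod r) \<in> {..<b} \<times> {..<r}"
      by (cases "r = 0") (auto simp: less_mult_imp_div_less)
  qed simp
  finally show ?thesis by simp
qed

lemma letter_morphism:
  assumes "\<And>c. c < m \<Longrightarrow> f c < b"
  shows "continuous_morphism m b (\<lambda>x n. f (x n))"
proof -
  have "continuous_map (seq_space m) (discrete_topology {..<b}) (\<lambda>x. f (x n))" for n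
  proof -
    have "continuous_map (seq_space m) (discrete_topology {..<m}) (\<lambda>x. x n)"
      unfolding seq_space_def by (rule continuous_map_product_projection) simp
    moreover have "continuous_map (discrete_topology {..<m}) (discrete_topology {..<b}) f"
      using assms by auto
    ultimately show ?thesis
      by (rule continuous_map_compose[unfolded o_def])
  qed
  then show ?thesis
    unfolding continuous_morphism_def
    by (auto simp: seq_space_def[of b] continuous_map_componentwise shift_def)
qed

lemma sum_blocks_1: "(\<Sum>u\<in>blocks m 1. g u) = (\<Sum>s<m. g [s])"
proof -
  have "blocks m 1 = (\<lambda>s. [s]) ` {..<m}"
    by (auto simp: blocks_def length_Suc_conv)
  then show ?thesis
    by (simp add: sum.reindex inj_on_def)
qed

text \<open>The state \<open>(a, j)\<close> is coded as the number \<open>a * r + j\<close>, so that \<open>s div r\<close> is the letter and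
  \<open>s mod r\<close> the index of a state \<open>s\<close>.\<close>

lemma linearly_representable_imp_sofic:
  assumes b: "b \<ge> 1" and \<eta>: "prob_measure_on_seq b \<eta>" and "linearly_representable b \<eta>"
  shows "sofic b \<eta>"
proof -
  obtain r :: nat and R M C where r: "r \<ge> 1" and rep: "represents b \<eta> {..<r} R M C"
    using assms(3) unfolding linearly_representable_iff by blast
  have Rnn: "\<And>a j. a < b \<Longrightarrow> j < r \<Longrightarrow> 0 \<le> R a j"
    and Mnn: "\<And>a i j. a < b \<Longrightarrow> i < r \<Longrightarrow> j < r \<Longrightarrow> 0 \<le> M a i j"
    and C: "\<And>j. j < r \<Longrightarrow> 0 < C j"
    and Rsum: "(\<Sum>j<r. (\<Sum>a<b. R a j) * C j) = 1"
    and Msum: "\<And>i. i < r \<Longrightarrow> (\<Sum>j<r. (\<Sum>a<b. M a i j) * C j) = C i"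
    and cyl: "\<And>a w. a # w \<in> words b \<Longrightarrow>
        measure \<eta> (cylinder b (a # w)) = (\<Sum>j<r. R a j * path_weight {..<r} M C w j)"
    using rep by (auto simp: represents_def)
  let ?m = "b * r"
  have m: "?m \<ge> 1" using b r by (simp add: Suc_le_eq)
  have div_less: "s div r < b" and mod_less: "s mod r < r" if "s < ?m" for s
    using that r by (auto simp: less_mult_imp_div_less)
  define p where "p s = R (s div r) (s mod r) * C (s mod r)" for s
  define P where "P s t = M (t div r) (s mod r) (t mod r) * C (t mod r) / C (s mod r)" for s t
  have pnn: "0 \<le> p s" if "s < ?m" for s
    using Rnn[OF div_less mod_less] C[OF mod_less] that by (simp add: p_def less_imp_le)
  have psum: "(\<Sum>s<?m. p s) = 1"
    unfolding p_def using Rsum by (subst sum_div_mod[of "\<lambda>a j. R a j * C j"], subst sum.swap)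
      (simp add: sum_distrib_right)
  have Pnn: "0 \<le> P s t" if "s < ?m" "t < ?m" for s t
    using Mnn[OF div_less mod_less mod_less] C[OF mod_less] that by (simp add: P_def less_imp_le)
  have Psum: "(\<Sum>t<?m. P s t) = 1" if "s < ?m" for s
  proof -
    have "(\<Sum>t<?m. P s t) = (\<Sum>a<b. \<Sum>j<r. M a (s mod r) j * C j / C (s mod r))"
      unfolding P_def by (rule sum_div_mod)
    also have "\<dots> = (\<Sum>j<r. (\<Sum>a<b. M a (s mod r) j) * C j) / C (s mod r)"
      by (subst sum.swap) (simp add: sum_distrib_right sum_divide_distrib)
    finally show ?thesis
      using Msum[OF mod_less[OF that]] C[OF mod_less[OF that]] by simp
  qed
  obtain \<mu> where \<mu>: "prob_measure_on_seq ?m \<mu>"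
    and \<mu>_cyl: "\<And>w. w \<in> words ?m \<Longrightarrow> measure \<mu> (cylinder ?m w) =
           p (w ! 0) * (\<Prod>k<length w - 1. P (w ! k) (w ! Suc k))"
    using markov_measure_exists[of ?m p P] pnn psum Pnn Psum by blast
  have markov: "markov_measure ?m \<mu>"
    unfolding markov_measure_def using \<mu> pnn psum Pnn Psum \<mu>_cyl by blast
  define \<phi> where "\<phi> = (\<lambda>(x :: nat \<Rightarrow> nat) n. x n div r)"
  define \<psi> where "\<psi> u = hd u div r" for u :: "nat list"
  have mor: "continuous_morphism ?m b \<phi>"
    unfolding \<phi>_def using div_less by (rule letter_morphism)
  have \<phi>: "\<phi> \<in> measurable \<mu> (seq_borel b)"
    using mor \<mu> by (auto simp: continuous_morphism_def intro: morphism_measurable)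
  \<comment> \<open>the telescoping of the factors \<open>C\<close> along a path leaves only its starting point in the denominator\<close>
  have fw: "future_weight ?m P \<psi> w [s] = path_weight {..<r} M C w (s mod r) / C (s mod r)"
    if "s < ?m" "set w \<subseteq> {..<b}" for w s
    using that
  proof (induction w arbitrary: s)
    case Nil
    then show ?case using C[OF mod_less[of s]] by simp
  next
    case (Cons a w)
    let ?pw = "path_weight {..<r} M C w"
    have "future_weight ?m P \<psi> (a # w) [s] = (\<Sum>t<?m. if t div r = a then
        M (t div r) (s mod r) (t mod r) * ?pw (t mod r) / C (s mod r) else 0)"
    proof -
      have "P s t * future_weight ?m P \<psi> w [t] =
          M (t div r) (s mod r) (t mod r) * ?pw (t mod r) / C (s mod r)" if "t < ?m" for t
      proof -
        have "future_weight ?m P \<psi> w [t] = ?pw (t mod r) / C (t mod r)"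
          using Cons.prems by (intro Cons.IH[OF that]) simp
        then show ?thesis
          using C[OF mod_less[OF that]] by (simp only:) (simp add: P_def)
      qed
      then show ?thesis
        by (auto simp: \<psi>_def intro!: sum.cong)
    qed
    also have "\<dots> = (\<Sum>a'<b. \<Sum>j<r. if a' = a then M a' (s mod r) j * ?pw j / C (s mod r) else 0)"
      by (rule sum_div_mod)
    also have "\<dots> = (\<Sum>a'<b. if a' = a then \<Sum>j<r. M a' (s mod r) j * ?pw j / C (s mod r) else 0)"
      by (intro sum.cong) auto
    also have "\<dots> = (\<Sum>j<r. M a (s mod r) j * ?pw j / C (s mod r))"
      using Cons.prems by simp
    also have "\<dots> = path_weight {..<r} M C (a # w) (s mod r) / C (s mod r)"
      by (simp add: sum_divide_distrib)
    finally show ?case .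
  qed
  have "\<eta> = distr \<mu> (seq_borel b) \<phi>"
  proof (rule prob_measure_on_seq_eqI[OF \<eta>])
    show "prob_measure_on_seq b (distr \<mu> (seq_borel b) \<phi>)"
      using prob_measure_on_seq_distr[OF prob_measure_on_seqD(1)[OF \<mu>] \<phi>] .
    fix v assume v: "v \<in> words b"
    then obtain a w where aw: "v = a # w" "a < b" "set w \<subseteq> {..<b}"
      by (cases v) (auto simp: words_def)
    have "measure (distr \<mu> (seq_borel b) \<phi>) (cylinder b v) =
        measure \<mu> {x \<in> space \<mu>. \<forall>i<length (a # w). \<psi> (map x [i..<i + 1]) = (a # w) ! i}"
      unfolding aw(1) by (rule measure_distr_cylinder[OF \<phi>]) (simp add: \<phi>_def \<psi>_def)
    also have "\<dots> = (\<Sum>u\<in>blocks ?m 1. if \<psi> u = a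
        then measure \<mu> (cylinder ?m u) * future_weight ?m P \<psi> w u else 0)"
      using \<mu>_cyl by (intro measure_block_event[OF \<mu>] markov_has_transitions[of _ _ p]) auto
    also have "\<dots> = (\<Sum>s<?m. if s div r = a then
        R (s div r) (s mod r) * path_weight {..<r} M C w (s mod r) else 0)"
      unfolding sum_blocks_1
    proof (rule sum.cong)
      fix s assume "s \<in> {..<?m}"
      then have s: "s < ?m" by simp
      then have "measure \<mu> (cylinder ?m [s]) = p s"
        using \<mu>_cyl[of "[s]"] by (simp add: words_def)
      then show "(if \<psi> [s] = a then measure \<mu> (cylinder ?m [s]) * future_weight ?m P \<psi> w [s] else 0) =
          (if s div r = a then R (s div r) (s mod r) * path_weight {..<r} M C w (s mod r) else 0)"
        using fw[OF s aw(3)] C[OF mod_less[OF s]] by (simp add: \<psi>_def p_def)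
    qed simp
    also have "\<dots> = (\<Sum>a'<b. \<Sum>j<r. if a' = a then R a' j * path_weight {..<r} M C w j else 0)"
      by (rule sum_div_mod)
    also have "\<dots> = (\<Sum>a'<b. if a' = a then \<Sum>j<r. R a' j * path_weight {..<r} M C w j else 0)"
      by (intro sum.cong) auto
    also have "\<dots> = (\<Sum>j<r. R a j * path_weight {..<r} M C w j)"
      using aw by simp
    finally show "measure \<eta> (cylinder b v) = measure (distr \<mu> (seq_borel b) \<phi>) (cylinder b v)"
      using cyl v aw by simp
  qed
  with m markov mor show ?thesis
    unfolding sofic_def by blast
qed

theorem theorem7:
  fixes b :: nat and \<eta> :: "(nat \<Rightarrow> nat) measure"
  assumes "b \<ge> 1" and "prob_measure_on_seq b \<eta>"
  shows "sofic b \<eta> \<longleftrightarrow> linearly_representable b \<eta>"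
  using assms sofic_imp_linearly_representable linearly_representable_imp_sofic by blast

end
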